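(* Let $(p,\mathbf{A})$ be a quantified relational structure of coverwidth $\le k$ (where $k\ge 1$), and let $\mathbf{B}$ be an arbitrary finite relational structure over the same signature as $\mathbf{A}$. There is a winning strategy for the Duplicator in the quantified $k$-cover game on $(p,\mathbf{A}),\mathbf{B}$ if and only if there is a homomorphism from $(p,\mathbf{A})$ to $\mathbf{B}$.
   Context: Relational structures have finite universes and relations $R^{\mathbf{A}}\subseteq A^r$ for each symbol $R$ of arity $r$ in a finite signature $\sigma$. A quantified relational structure is a pair $(p,\mathbf{A})$ where $p=Q_1v_1\ldots Q_nv_n$ is a quantifier prefix, each $Q_i\in\{\exists,\forall\}$ and $v_1,\ldots,v_n$ exactly the elements of the universe $A$. There is a homomorphism from $(p,\mathbf{A})$ to $\mathbf{B}$ iff $\mathbf{B}$ satisfies the sentence $p\,\bigwedge\{R(a_1,\ldots,a_r): R\in\sigma, (a_1,\ldots,a_r)\in R^{\mathbf{A}}\}$. The prefix splits into maximal blocks of equal quantifiers; $v_j$ comes after $v_i$ in $p$ if they are in the same block or $v_j$'s block follows $v_i$'s block. $H(\mathbf{A})$ is the hypergraph on $A$ with a hyperedge $\{a_1,\ldots,a_r\}$ per tuple of any relation of $\mathbf{A}$. A $k$-union is a union of $k$ hyperedges (the empty set is the $0$-union); the weight of $X\subseteq A$ is the least $k\ge0$ with $X\cap\bigcup_e e$ contained in a $k$-union. A scheme of $(p,\mathbf{A})$ is a graph $(A,F)$ in which every hyperedge of $H(\mathbf{A})$ induces a clique and which has a perfect elimination ordering $v_1,\ldots,v_n$ (for all $i<j<l$,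 if $\{v_i,v_l\},\{v_j,v_l\}\in F$ then $\{v_i,v_j\}\in F$) respecting $p$: if $i<j$ then $v_j$ comes after $v_i$ in $p$. The weight of a scheme is the maximum weight of its cliques; the coverwidth of $(p,\mathbf{A})$ is the minimum weight over all its schemes. A projective homomorphism from $\mathbf{A}$ to $\mathbf{B}$ is a partial function $h$ from $A$ to $B$ such that for every $R$ and $(a_1,\ldots,a_r)\in R^{\mathbf{A}}$ there is $(b_1,\ldots,b_r)\in R^{\mathbf{B}}$ with $h(a_i)=b_i$ for all $a_i\in\mathsf{dom}(h)$. A winning strategy for the Duplicator in the quantified $k$-cover game on $(p,\mathbf{A}),\mathbf{B}$ is a non-empty set $H$ of projective homomorphisms from $\mathbf{A}$ to $\mathbf{B}$ such that: (1) for every $h\in H$ and every existentially quantified $a\notin\mathsf{dom}(h)$ coming after all elements of $\mathsf{dom}(h)$ with $\mathsf{dom}(h)\cup\{a\}$ of weight $\le k$, some $h'\in H$ extends $h$ with $\mathsf{dom}(h')=\mathsf{dom}(h)\cup\{a\}$; (2) for every $h\in H$, every $b\in B$, and every universally quantified $a\notin\mathsf{dom}(h)$ coming after all elements of $\mathsf{dom}(h)$ with $\mathsf{dom}(h)\cup\{a\}$ of weight $\le k$, some $h'\in H$ extends $h$ with $\mathsf{dom}(h')=\mathsf{dom}(h)\cup\{a\}$ and $h'(a)=b$; (3) $H$ is closed under subfunctions. *)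

theory Defs
  imports Main
begin

record 's signature =
  symbols :: "'s set"
  arity :: "'s \<Rightarrow> nat"

record ('s, 'a) rel_structure =
  universe :: "'a set"
  interp :: "'s \<Rightarrow> 'a list set"

definition finite_signature :: "'s signature \<Rightarrow> bool" where
  "finite_signature \<sigma> \<longleftrightarrow> finite (symbols \<sigma>)"

text \<open>Only the interpretation of symbols in the signature is constrained, and only it is
  inspected below. The empty universe is not excluded here.\<close>

definition is_structure :: "'s signature \<Rightarrow> ('s, 'a) rel_structure \<Rightarrow> bool" where
  "is_structure \<sigma> A \<longleftrightarrow> finite (universe A) \<and>
     (\<forall>R\<in>symbols \<sigma>. \<forall>as\<in>interp A R. length as = arity \<sigma> R \<and> set as \<subseteq> universe A)"

datatype quantifier = Existential | Universal

type_synonym 'a prefix = "(quantifier \<times> 'a) list"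

definition is_quantified_structure ::
    "'s signature \<Rightarrow> 'a prefix \<Rightarrow> ('s, 'a) rel_structure \<Rightarrow> bool" where
  "is_quantified_structure \<sigma> p A \<longleftrightarrow>
     is_structure \<sigma> A \<and> distinct (map snd p) \<and> set (map snd p) = universe A"

text \<open>Truth of a prenex formula in a structure with universe \<open>D\<close> under the assignment \<open>s\<close>;
  the quantifier-free matrix is given semantically by \<open>\<phi>\<close>.\<close>

fun prenex_holds ::
    "'b set \<Rightarrow> 'a prefix \<Rightarrow> (('a \<Rightarrow> 'b) \<Rightarrow> bool) \<Rightarrow> ('a \<Rightarrow> 'b) \<Rightarrow> bool" where
  "prenex_holds D [] \<phi> s \<longleftrightarrow> \<phi> s"
| "prenex_holds D ((Existential, v) # p) \<phi> s \<longleftrightarrow> (\<exists>b\<in>D. prenex_holds D p \<phi> (s(v := b)))"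
| "prenex_holds D ((Universal, v) # p) \<phi> s \<longleftrightarrow> (\<forall>b\<in>D. prenex_holds D p \<phi> (s(v := b)))"

definition canonical_conjunction ::
    "'s signature \<Rightarrow> ('s, 'a) rel_structure \<Rightarrow> ('s, 'b) rel_structure \<Rightarrow> ('a \<Rightarrow> 'b) \<Rightarrow> bool" where
  "canonical_conjunction \<sigma> A B s \<longleftrightarrow>
     (\<forall>R\<in>symbols \<sigma>. \<forall>as\<in>interp A R. map s as \<in> interp B R)"

text \<open>The initial assignment \<open>s\<close> is immaterial when \<open>p\<close> quantifies all elements of \<open>A\<close>.\<close>

definition has_homomorphism ::
    "'s signature \<Rightarrow> 'a prefix \<Rightarrow> ('s, 'a) rel_structure \<Rightarrow> ('s, 'b) rel_structure \<Rightarrow> bool" where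
  "has_homomorphism \<sigma> p A B \<longleftrightarrow>
     (\<forall>s. prenex_holds (universe B) p (canonical_conjunction \<sigma> A B) s)"

text \<open>The index of the maximal block containing position \<open>i\<close> is the number of quantifier
  alternations up to that position.\<close>

definition block_index :: "'a prefix \<Rightarrow> nat \<Rightarrow> nat" where
  "block_index p i = card {j. j < i \<and> fst (p ! j) \<noteq> fst (p ! Suc j)}"

text \<open>\<open>comes_after p u v\<close>: \<open>u\<close> comes after \<open>v\<close>. Within a block this holds in both directions.\<close>

definition comes_after :: "'a prefix \<Rightarrow> 'a \<Rightarrow> 'a \<Rightarrow> bool" where
  "comes_after p u v \<longleftrightarrow> (\<exists>i j. i < length p \<and> j < length p \<and>
     snd (p ! i) = v \<and> snd (p ! j) = u \<and> block_index p i \<le> block_index p j)"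

definition hyperedges :: "'s signature \<Rightarrow> ('s, 'a) rel_structure \<Rightarrow> 'a set set" where
  "hyperedges \<sigma> A = (\<Union>R\<in>symbols \<sigma>. set ` interp A R)"

definition is_k_union :: "'s signature \<Rightarrow> ('s, 'a) rel_structure \<Rightarrow> nat \<Rightarrow> 'a set \<Rightarrow> bool" where
  "is_k_union \<sigma> A k U \<longleftrightarrow>
     (\<exists>E \<subseteq> hyperedges \<sigma> A. finite E \<and> card E = k \<and> U = \<Union>E)"

definition weight :: "'s signature \<Rightarrow> ('s, 'a) rel_structure \<Rightarrow> 'a set \<Rightarrow> nat" where
  "weight \<sigma> A X =
     (LEAST k. \<exists>U. is_k_union \<sigma> A k U \<and> X \<inter> \<Union>(hyperedges \<sigma> A) \<subseteq> U)"

text \<open>A graph on a vertex set \<open>V\<close> is given by its set \<open>F\<close> of two-element edges.\<close>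

definition is_graph :: "'a set \<Rightarrow> 'a set set \<Rightarrow> bool" where
  "is_graph V F \<longleftrightarrow> (\<forall>e\<in>F. e \<subseteq> V \<and> card e = 2)"

definition is_clique :: "'a set \<Rightarrow> 'a set set \<Rightarrow> 'a set \<Rightarrow> bool" where
  "is_clique V F K \<longleftrightarrow> K \<subseteq> V \<and> (\<forall>u\<in>K. \<forall>v\<in>K. u \<noteq> v \<longrightarrow> {u, v} \<in> F)"

definition perfect_elimination_ordering :: "'a set \<Rightarrow> 'a set set \<Rightarrow> 'a list \<Rightarrow> bool" where
  "perfect_elimination_ordering V F vs \<longleftrightarrow> distinct vs \<and> set vs = V \<and>
     (\<forall>i j l. i < j \<and> j < l \<and> l < length vs \<and> {vs ! i, vs ! l} \<in> F \<and> {vs ! j, vs ! l} \<in> F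
        \<longrightarrow> {vs ! i, vs ! j} \<in> F)"

definition respects_prefix :: "'a prefix \<Rightarrow> 'a list \<Rightarrow> bool" where
  "respects_prefix p vs \<longleftrightarrow>
     (\<forall>i j. i < j \<and> j < length vs \<longrightarrow> comes_after p (vs ! j) (vs ! i))"

definition is_scheme ::
    "'s signature \<Rightarrow> 'a prefix \<Rightarrow> ('s, 'a) rel_structure \<Rightarrow> 'a set set \<Rightarrow> bool" where
  "is_scheme \<sigma> p A F \<longleftrightarrow> is_graph (universe A) F \<and>
     (\<forall>e\<in>hyperedges \<sigma> A. is_clique (universe A) F e) \<and>
     (\<exists>vs. perfect_elimination_ordering (universe A) F vs \<and> respects_prefix p vs)"

definition scheme_weight :: "'s signature \<Rightarrow> ('s, 'a) rel_structure \<Rightarrow> 'a set set \<Rightarrow> nat" where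
  "scheme_weight \<sigma> A F = Max (weight \<sigma> A ` {K. is_clique (universe A) F K})"

text \<open>The complete graph, ordered as in \<open>p\<close>, is always a scheme, so the minimum exists.\<close>

definition coverwidth :: "'s signature \<Rightarrow> 'a prefix \<Rightarrow> ('s, 'a) rel_structure \<Rightarrow> nat" where
  "coverwidth \<sigma> p A = (LEAST w. \<exists>F. is_scheme \<sigma> p A F \<and> scheme_weight \<sigma> A F = w)"

definition projective_homomorphism ::
    "'s signature \<Rightarrow> ('s, 'a) rel_structure \<Rightarrow> ('s, 'b) rel_structure \<Rightarrow> ('a \<rightharpoonup> 'b) \<Rightarrow> bool" where
  "projective_homomorphism \<sigma> A B h \<longleftrightarrow> dom h \<subseteq> universe A \<and> ran h \<subseteq> universe B \<and>
     (\<forall>R\<in>symbols \<sigma>. \<forall>as\<in>interp A R. \<exists>bs\<in>interp B R.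
        \<forall>i<length as. as ! i \<in> dom h \<longrightarrow> h (as ! i) = Some (bs ! i))"

definition winning_strategy ::
    "'s signature \<Rightarrow> nat \<Rightarrow> 'a prefix \<Rightarrow> ('s, 'a) rel_structure \<Rightarrow> ('s, 'b) rel_structure
       \<Rightarrow> ('a \<rightharpoonup> 'b) set \<Rightarrow> bool" where
  "winning_strategy \<sigma> k p A B H \<longleftrightarrow>
     H \<noteq> {} \<and> (\<forall>h\<in>H. projective_homomorphism \<sigma> A B h) \<and>
     (\<forall>h\<in>H. \<forall>a. (Existential, a) \<in> set p \<and> a \<notin> dom h \<and> (\<forall>u\<in>dom h. comes_after p a u) \<and>
        weight \<sigma> A (insert a (dom h)) \<le> k
        \<longrightarrow> (\<exists>h'\<in>H. h \<subseteq>\<^sub>m h' \<and> dom h' = insert a (dom h))) \<and>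
     (\<forall>h\<in>H. \<forall>b\<in>universe B. \<forall>a. (Universal, a) \<in> set p \<and> a \<notin> dom h \<and>
        (\<forall>u\<in>dom h. comes_after p a u) \<and> weight \<sigma> A (insert a (dom h)) \<le> k
        \<longrightarrow> (\<exists>h'\<in>H. h \<subseteq>\<^sub>m h' \<and> dom h' = insert a (dom h) \<and> h' a = Some b)) \<and>
     (\<forall>h\<in>H. \<forall>g. g \<subseteq>\<^sub>m h \<longrightarrow> g \<in> H)"

end

(* Truth of a prenex sentence means that Skolem functions exist: a map F from assignments u of the
   universal variables to full assignments such that the value of an existential variable depends
   only on the universal variables preceding it in the prefix. Given such an F, the restrictions of
   all F u form a winning strategy, since F u and F (u(a := b)) agree on every variable other than a
   that a comes after. Conversely, let the elements of A be valued one by one along a perfect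
   elimination ordering of an optimal scheme. The earlier neighbours of an element x form, together
   with x, a clique, which has weight at most k; hence the strategy answers x relative to the
   restriction to these neighbours, and inductively every restriction to a clique stays in the
   strategy. As hyperedges are cliques, the final assignment satisfies the matrix. The elimination
   ordering may permute the variables inside a block of the prefix, but this does not change which
   universal variables precede an existential one. *)

theory Submission
  imports Defs
begin

section \<open>Skolem functions for prenex sentences\<close>

text \<open>All Skolem functions are packed into one map \<open>F\<close>, and dependence on earlier
  universal variables is expressed by agreement of assignments instead of functions of varying
  arity. The initial assignment \<open>s\<close> fixes variables outside \<open>p\<close>, so that
  an induction on the prefix can store values already chosen there.\<close>

definition skolemizes ::
    "'b set \<Rightarrow> 'a prefix \<Rightarrow> (('a \<Rightarrow> 'b) \<Rightarrow> bool) \<Rightarrow> ('a \<Rightarrow> 'b) \<Rightarrow> (('a \<Rightarrow> 'b) \<Rightarrow> 'a \<Rightarrow> 'b) \<Rightarrow> bool" where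
  "skolemizes D p \<phi> s F \<longleftrightarrow>
     (\<forall>u. range u \<subseteq> D \<longrightarrow> \<phi> (F u) \<and> (\<forall>x\<in>snd ` set p. F u x \<in> D) \<and>
        (\<forall>x. x \<notin> snd ` set p \<longrightarrow> F u x = s x) \<and> (\<forall>x. (Universal, x) \<in> set p \<longrightarrow> F u x = u x)) \<and>
     (\<forall>u u' ps x qs. range u \<subseteq> D \<and> range u' \<subseteq> D \<and> p = ps @ (Existential, x) # qs \<and>
        (\<forall>y. (Universal, y) \<in> set ps \<longrightarrow> u y = u' y) \<longrightarrow> F u x = F u' x)"

lemma skolemizesI:
  fixes D :: "'b set" and p :: "'a prefix"
  assumes "\<And>u. range u \<subseteq> D \<Longrightarrow> \<phi> (F u)"
    and "\<And>u x. range u \<subseteq> D \<Longrightarrow> x \<in> snd ` set p \<Longrightarrow> F u x \<in> D"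
    and "\<And>u x. range u \<subseteq> D \<Longrightarrow> x \<notin> snd ` set p \<Longrightarrow> F u x = s x"
    and "\<And>u x. range u \<subseteq> D \<Longrightarrow> (Universal, x) \<in> set p \<Longrightarrow> F u x = u x"
    and "\<And>u u' ps x qs. range u \<subseteq> D \<Longrightarrow> range u' \<subseteq> D \<Longrightarrow> p = ps @ (Existential, x) # qs \<Longrightarrow>
           (\<And>y. (Universal, y) \<in> set ps \<Longrightarrow> u y = u' y) \<Longrightarrow> F u x = F u' x"
  shows "skolemizes D p \<phi> s F"
  unfolding skolemizes_def
  apply (intro conjI allI impI ballI)
  subgoal by (rule assms(1))
  subgoal by (rule assms(2))
  subgoal by (rule assms(3))
  subgoal by (rule assms(4))
  subgoal for u u' ps x qs by (elim conjE, rule assms(5)[of u u' ps x qs]) simp_all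
  done

lemma skolemizesD:
  assumes "skolemizes D p \<phi> s F" and "range u \<subseteq> D"
  shows "\<phi> (F u)"
    and "x \<in> snd ` set p \<Longrightarrow> F u x \<in> D"
    and "x \<notin> snd ` set p \<Longrightarrow> F u x = s x"
    and "(Universal, x) \<in> set p \<Longrightarrow> F u x = u x"
  using assms unfolding skolemizes_def by blast+

lemma skolemizes_cong:
  assumes "skolemizes D p \<phi> s F" and "range u \<subseteq> D" and "range u' \<subseteq> D"
    and "p = ps @ (Existential, x) # qs" and "\<And>y. (Universal, y) \<in> set ps \<Longrightarrow> u y = u' y"
  shows "F u x = F u' x"
  using assms unfolding skolemizes_def by blast

text \<open>The witness \<open>b\<close> sits in the initial assignment. As \<open>v\<close> is not
  quantified in \<open>p\<close>, every \<open>F u\<close> returns \<open>b\<close> at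
  \<open>v\<close>, so the same \<open>F\<close> serves for the longer prefix.\<close>

lemma skolemizes_Existential:
  fixes D :: "'b set" and p :: "'a prefix"
  assumes F: "skolemizes D p \<phi> (s(v := b)) F" and v: "v \<notin> snd ` set p" and b: "b \<in> D"
  shows "skolemizes D ((Existential, v) # p) \<phi> s F"
proof (rule skolemizesI)
  fix u :: "'a \<Rightarrow> 'b" and x assume u: "range u \<subseteq> D"
  note * = skolemizesD[OF F u]
  show "\<phi> (F u)" by (rule *)
  show "F u x \<in> D" if "x \<in> snd ` set ((Existential, v) # p)"
    using that *(2)[of x] *(3)[OF v] b by auto
  show "F u x = s x" if "x \<notin> snd ` set ((Existential, v) # p)"
    using that *(3)[of x] by auto
  show "F u x = u x" if "(Universal, x) \<in> set ((Existential, v) # p)"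
    using that *(4)[of x] by auto
next
  fix u u' :: "'a \<Rightarrow> 'b" and ps x qs
  assume u: "range u \<subseteq> D" "range u' \<subseteq> D" and eq: "(Existential, v) # p = ps @ (Existential, x) # qs"
    and agree: "\<And>y. (Universal, y) \<in> set ps \<Longrightarrow> u y = u' y"
  show "F u x = F u' x"
  proof (cases ps)
    case Nil
    then show ?thesis
      using eq skolemizesD(3)[OF F u(1) v] skolemizesD(3)[OF F u(2) v] by simp
  next
    case (Cons q ps')
    then show ?thesis using eq agree by (auto intro: skolemizes_cong[OF F u, of ps' x qs])
  qed
qed

text \<open>The value \<open>u v\<close> selects a member of the family \<open>F\<close>.
  Assignments that agree on the universal variables before an existential one agree at
  \<open>v\<close>, hence select the same member.\<close>

lemma skolemizes_Universal:
  fixes D :: "'b set" and p :: "'a prefix"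
  assumes F: "\<And>b. b \<in> D \<Longrightarrow> skolemizes D p \<phi> (s(v := b)) (F b)" and v: "v \<notin> snd ` set p"
  shows "skolemizes D ((Universal, v) # p) \<phi> s (\<lambda>u. F (u v) u)"
proof (rule skolemizesI)
  fix u :: "'a \<Rightarrow> 'b" and x assume u: "range u \<subseteq> D"
  then have uv: "u v \<in> D" by auto
  note * = skolemizesD[OF F[OF uv] u]
  show "\<phi> (F (u v) u)" by (rule *)
  show "F (u v) u x \<in> D" if "x \<in> snd ` set ((Universal, v) # p)"
    using that *(2)[of x] *(3)[OF v] uv by auto
  show "F (u v) u x = s x" if "x \<notin> snd ` set ((Universal, v) # p)"
    using that *(3)[of x] by auto
  show "F (u v) u x = u x" if "(Universal, x) \<in> set ((Universal, v) # p)"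
    using that *(4)[of x] *(3)[OF v] by auto
next
  fix u u' :: "'a \<Rightarrow> 'b" and ps x qs
  assume u: "range u \<subseteq> D" "range u' \<subseteq> D" and eq: "(Universal, v) # p = ps @ (Existential, x) # qs"
    and agree: "\<And>y. (Universal, y) \<in> set ps \<Longrightarrow> u y = u' y"
  from eq obtain ps' where ps: "ps = (Universal, v) # ps'" "p = ps' @ (Existential, x) # qs"
    by (cases ps) auto
  have "u v = u' v" using agree ps by simp
  moreover have "F (u v) u x = F (u v) u' x"
    using u agree ps by (intro skolemizes_cong[OF F u, of "u v" ps' x qs]) auto
  ultimately show "F (u v) u x = F (u' v) u' x" by simp
qed

text \<open>Nothing precedes the leading variable, so \<open>F\<close> is constant at
  \<open>v\<close>; evaluating it at a constant assignment yields the witness.\<close>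

lemma skolemizes_Existential_tail:
  fixes D :: "'b set" and p :: "'a prefix"
  assumes F: "skolemizes D ((Existential, v) # p) \<phi> s F" and "d \<in> D"
  defines "b \<equiv> F (\<lambda>_. d) v"
  shows "b \<in> D" and "skolemizes D p \<phi> (s(v := b)) F"
proof -
  have d: "range (\<lambda>_ :: 'a. d) \<subseteq> D" using assms(2) by auto
  show "b \<in> D" unfolding b_def by (rule skolemizesD(2)[OF F d]) simp
  have const: "F u v = b" if "range u \<subseteq> D" for u
    unfolding b_def by (rule skolemizes_cong[OF F that d, of "[]"]) auto
  show "skolemizes D p \<phi> (s(v := b)) F"
  proof (rule skolemizesI)
    fix u :: "'a \<Rightarrow> 'b" and x assume u: "range u \<subseteq> D"
    note * = skolemizesD[OF F u]
    show "\<phi> (F u)" by (rule *)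
    show "F u x \<in> D" if "x \<in> snd ` set p" using that *(2)[of x] by auto
    show "F u x = (s(v := b)) x" if "x \<notin> snd ` set p"
      using that *(3)[of x] const[OF u] by auto
    show "F u x = u x" if "(Universal, x) \<in> set p" using that *(4)[of x] by auto
  next
    fix u u' :: "'a \<Rightarrow> 'b" and ps x qs
    assume u: "range u \<subseteq> D" "range u' \<subseteq> D" and p: "p = ps @ (Existential, x) # qs"
      and agree: "\<And>y. (Universal, y) \<in> set ps \<Longrightarrow> u y = u' y"
    show "F u x = F u' x"
      by (rule skolemizes_cong[OF F u, of "(Existential, v) # ps" x qs]) (auto simp: p agree)
  qed
qed

text \<open>\<open>F\<close> may consult \<open>u v\<close>, so this value is overwritten by
  \<open>b\<close>. The overwritten assignments then agree at \<open>v\<close> as well, as the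
  longer prefix demands.\<close>

lemma skolemizes_Universal_tail:
  fixes D :: "'b set" and p :: "'a prefix"
  assumes F: "skolemizes D ((Universal, v) # p) \<phi> s F" and v: "v \<notin> snd ` set p" and b: "b \<in> D"
  shows "skolemizes D p \<phi> (s(v := b)) (\<lambda>u. F (u(v := b)))"
proof (rule skolemizesI)
  have upd: "range (u(v := b)) \<subseteq> D" if "range u \<subseteq> D" for u :: "'a \<Rightarrow> 'b" using that b by auto
  {
    fix u :: "'a \<Rightarrow> 'b" and x assume u: "range u \<subseteq> D"
    note * = skolemizesD[OF F upd[OF u]]
    show "\<phi> (F (u(v := b)))" by (rule *)
    show "F (u(v := b)) x \<in> D" if "x \<in> snd ` set p" using that *(2)[of x] by auto
    show "F (u(v := b)) x = (s(v := b)) x" if "x \<notin> snd ` set p"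
      using that *(3)[of x] *(4)[of v] by auto
    show "F (u(v := b)) x = u x" if "(Universal, x) \<in> set p"
    proof -
      have "x \<noteq> v" using that v by force
      then show ?thesis using that *(4)[of x] by auto
    qed
  next
    fix u u' :: "'a \<Rightarrow> 'b" and ps x qs
    assume u: "range u \<subseteq> D" "range u' \<subseteq> D" and p: "p = ps @ (Existential, x) # qs"
      and agree: "\<And>y. (Universal, y) \<in> set ps \<Longrightarrow> u y = u' y"
    show "F (u(v := b)) x = F (u'(v := b)) x"
      by (rule skolemizes_cong[OF F upd[OF u(1)] upd[OF u(2)], of "(Universal, v) # ps" x qs])
        (auto simp: p agree)
  }
qed

text \<open>Induction on the prefix, one quantifier at a time. If \<open>D\<close> were empty, no
  \<open>u\<close> would have its range in \<open>D\<close> and the right side would hold vacuously,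
  even for a false sentence.\<close>

lemma prenex_holds_iff_skolemizes:
  fixes D :: "'b set" and p :: "'a prefix"
  assumes "distinct (map snd p)" and "D \<noteq> {}"
  shows "prenex_holds D p \<phi> s \<longleftrightarrow> (\<exists>F. skolemizes D p \<phi> s F)"
  using assms(1)
proof (induction p arbitrary: s)
  case Nil
  obtain d where d: "d \<in> D" using assms(2) by blast
  show ?case
  proof
    show "\<exists>F. skolemizes D [] \<phi> s F" if "prenex_holds D [] \<phi> s"
      using that by (intro exI[of _ "\<lambda>_. s"]) (auto simp: skolemizes_def)
    show "prenex_holds D [] \<phi> s" if "\<exists>F. skolemizes D [] \<phi> s F"
    proof -
      from that obtain F where F: "skolemizes D [] \<phi> s F" ..
      have u: "range (\<lambda>_ :: 'a. d) \<subseteq> D" using d by auto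
      have "F (\<lambda>_. d) = s" using skolemizesD(3)[OF F u] by auto
      then show ?thesis using skolemizesD(1)[OF F u] by simp
    qed
  qed
next
  case (Cons qv p)
  obtain q v where qv: "qv = (q, v)" by (cases qv)
  have v: "v \<notin> snd ` set p" and dist: "distinct (map snd p)" using Cons.prems qv by simp_all
  note IH = Cons.IH[OF dist]
  obtain d where d: "d \<in> D" using assms(2) by blast
  show ?case
  proof (cases q)
    case Existential
    have "(\<exists>b\<in>D. \<exists>F. skolemizes D p \<phi> (s(v := b)) F) \<longleftrightarrow>
          (\<exists>F. skolemizes D ((Existential, v) # p) \<phi> s F)" (is "?L \<longleftrightarrow> ?R")
    proof
      assume ?L
      then obtain b F where "b \<in> D" "skolemizes D p \<phi> (s(v := b)) F" by blast
      then show ?R by - (rule exI, rule skolemizes_Existential[OF _ v])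
    next
      assume ?R
      then obtain F where F: "skolemizes D ((Existential, v) # p) \<phi> s F" ..
      show ?L
        by (rule bexI, rule exI, rule skolemizes_Existential_tail(2)[OF F d])
          (rule skolemizes_Existential_tail(1)[OF F d])
    qed
    then show ?thesis unfolding qv Existential prenex_holds.simps IH .
  next
    case Universal
    have "(\<forall>b\<in>D. \<exists>F. skolemizes D p \<phi> (s(v := b)) F) \<longleftrightarrow>
          (\<exists>F. skolemizes D ((Universal, v) # p) \<phi> s F)" (is "?L \<longleftrightarrow> ?R")
    proof
      assume ?L
      \<comment> \<open>Choice: one Skolem map for each value of the universal variable.\<close>
      then obtain F where "\<And>b. b \<in> D \<Longrightarrow> skolemizes D p \<phi> (s(v := b)) (F b)" by metis
      then show ?R by - (rule exI, rule skolemizes_Universal[OF _ v])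
    next
      assume ?R
      then obtain F where F: "skolemizes D ((Universal, v) # p) \<phi> s F" ..
      show ?L by (rule ballI, rule exI, rule skolemizes_Universal_tail[OF F v])
    qed
    then show ?thesis unfolding qv Universal prenex_holds.simps IH .
  qed
qed

section \<open>Blocks and positions in the prefix\<close>

lemma block_index_mono: "i \<le> j \<Longrightarrow> block_index p i \<le> block_index p j"
  unfolding block_index_def by (intro card_mono) auto

text \<open>Between \<open>i\<close> and \<open>j\<close> the quantifier changes at some pair of
  consecutive positions; this alternation is counted for \<open>j\<close> but not for
  \<open>i\<close>.\<close>

lemma block_index_less:
  assumes "i < j" and "fst (p ! i) \<noteq> fst (p ! j)"
  shows "block_index p i < block_index p j"
proof -
  have "\<exists>m. i \<le> m \<and> m < j \<and> fst (p ! m) \<noteq> fst (p ! Suc m)"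
  proof (rule ccontr)
    assume no: "\<not> ?thesis"
    have "fst (p ! m) = fst (p ! i)" if "i \<le> m" "m \<le> j" for m
      using that
    proof (induction m rule: dec_induct)
      case (step n)
      then show ?case using no by (metis Suc_le_lessD less_imp_le)
    qed simp
    then show False using assms by (metis less_imp_le order_refl)
  qed
  then obtain m where m: "i \<le> m" "m < j" "fst (p ! m) \<noteq> fst (p ! Suc m)" by blast
  then have "m \<in> {l. l < j \<and> fst (p ! l) \<noteq> fst (p ! Suc l)}"
    and "m \<notin> {l. l < i \<and> fst (p ! l) \<noteq> fst (p ! Suc l)}" by auto
  then show ?thesis
    unfolding block_index_def using assms(1) by (intro psubset_card_mono) auto
qed

text \<open>Differently quantified variables lie in different blocks, so between them the block
  order is the strict order of positions. Distinctness ties each variable to a single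
  position.\<close>

lemma comes_after_nth_less:
  assumes "distinct (map snd p)" and "i < length p" and "j < length p"
    and "fst (p ! i) \<noteq> fst (p ! j)" and "comes_after p (snd (p ! j)) (snd (p ! i))"
  shows "i < j"
proof -
  obtain i' j' where ij: "i' < length p" "j' < length p" "snd (p ! i') = snd (p ! i)"
      "snd (p ! j') = snd (p ! j)" "block_index p i' \<le> block_index p j'"
    using assms(5) unfolding comes_after_def by blast
  have "i' = i" "j' = j"
    using ij nth_eq_iff_index_eq[OF assms(1), of i' i] nth_eq_iff_index_eq[OF assms(1), of j' j]
      assms(2,3) by auto
  with ij have "\<not> block_index p j < block_index p i" by simp
  with block_index_less[of j i p] assms(4) have "\<not> j < i" by auto
  with assms(4) show ?thesis by (metis linorder_neqE_nat)
qed

text \<open>Serves to show that a universal variable valued before an existential one in an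
  elimination ordering is one that its Skolem function may use.\<close>

lemma comes_after_precedes:
  assumes "distinct (map snd p)" and p: "p = ps @ (q, x) # qs"
    and "(q', y) \<in> set p" and "q \<noteq> q'" and "comes_after p x y"
  shows "(q', y) \<in> set ps"
proof -
  obtain i where i: "i < length p" "p ! i = (q', y)" using assms(3) by (auto simp: in_set_conv_nth)
  have j: "p ! length ps = (q, x)" "length ps < length p" by (auto simp: p)
  have "i < length ps"
    using comes_after_nth_less[OF assms(1) i(1) j(2)] i(2) j(1) assms(4,5) by simp
  then show ?thesis using i by (auto simp: p nth_append in_set_conv_nth)
qed

text \<open>Serves to show that changing the value of a newly played universal variable leaves the
  existential values already on the board intact.\<close>

lemma comes_after_not_precedes:
  assumes "distinct (map snd p)" and p: "p = ps @ (q, x) # qs"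
    and "q \<noteq> q'" and "comes_after p y x"
  shows "(q', y) \<notin> set ps"
proof
  assume "(q', y) \<in> set ps"
  then obtain i where i: "i < length ps" "ps ! i = (q', y)" by (auto simp: in_set_conv_nth)
  have j: "p ! length ps = (q, x)" "length ps < length p" by (auto simp: p)
  have "i < length p" "p ! i = (q', y)" using i by (auto simp: p nth_append)
  then show False
    using comes_after_nth_less[OF assms(1) j(2), of i] i j assms(3,4) by simp
qed

section \<open>From Skolem functions to a winning strategy\<close>

lemma winning_strategy_of_skolemizes:
  assumes A: "is_quantified_structure \<sigma> p A" and "universe B \<noteq> {}"
    and F: "skolemizes (universe B) p (canonical_conjunction \<sigma> A B) s F"
  defines "H \<equiv> {h. \<exists>u. range u \<subseteq> universe B \<and> h \<subseteq>\<^sub>m (\<lambda>x. Some (F u x)) |` universe A}"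
  shows "winning_strategy \<sigma> k p A B H"
proof -
  let ?full = "\<lambda>u. (\<lambda>x. Some (F u x)) |` universe A"
  have dist: "distinct (map snd p)" and vars: "snd ` set p = universe A"
    using A by (auto simp: is_quantified_structure_def)
  have val: "h x = Some (F u x)" if "h \<subseteq>\<^sub>m ?full u" "x \<in> dom h" for h u x
    using that unfolding map_le_def by (metis (lifting) domIff restrict_map_def)
  have dom: "dom h \<subseteq> universe A" if "h \<subseteq>\<^sub>m ?full u" for h u
    using map_le_implies_dom_le[OF that] by auto
  have ext: "h(a \<mapsto> F u a) \<subseteq>\<^sub>m ?full u" if "h \<subseteq>\<^sub>m ?full u" "a \<in> universe A" for h u a
    using that by (auto simp: map_le_def restrict_map_def)
  have ne: "H \<noteq> {}"
  proof -
    obtain b where "b \<in> universe B" using assms(2) by blast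
    then have "Map.empty \<in> H" unfolding H_def by (auto intro!: exI[of _ "\<lambda>_. b"])
    then show ?thesis by blast
  qed
  have proj: "projective_homomorphism \<sigma> A B h" if "h \<in> H" for h
  proof -
    obtain u where u: "range u \<subseteq> universe B" and h: "h \<subseteq>\<^sub>m ?full u"
      using \<open>h \<in> H\<close> by (auto simp: H_def)
    have "ran h \<subseteq> universe B"
    proof
      fix b assume "b \<in> ran h"
      then obtain x where x: "h x = Some b" by (auto simp: ran_def)
      then have "x \<in> dom h" by auto
      then show "b \<in> universe B"
        using val[OF h] x dom[OF h] skolemizesD(2)[OF F u, of x] vars by auto
    qed
    moreover have "\<exists>bs\<in>interp B R. \<forall>i<length as. as ! i \<in> dom h \<longrightarrow> h (as ! i) = Some (bs ! i)"
      if "R \<in> symbols \<sigma>" "as \<in> interp A R" for R as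
      \<comment> \<open>The witness is the image of \<open>as\<close> under the total map
        \<open>F u\<close>, which also fills the positions outside \<open>dom h\<close>.\<close>
      using skolemizesD(1)[OF F u] that val[OF h]
      by (intro bexI[of _ "map (F u) as"]) (auto simp: canonical_conjunction_def)
    ultimately show ?thesis using dom[OF h] by (auto simp: projective_homomorphism_def)
  qed
  \<comment> \<open>An existential move is answered by the \<open>F u\<close> that \<open>h\<close>
    already restricts.\<close>
  have ex: "\<exists>h'\<in>H. h \<subseteq>\<^sub>m h' \<and> dom h' = insert a (dom h)"
    if "h \<in> H" "(Existential, a) \<in> set p" "a \<notin> dom h" for h a
  proof -
    obtain u where u: "range u \<subseteq> universe B" and h: "h \<subseteq>\<^sub>m ?full u"
      using \<open>h \<in> H\<close> by (auto simp: H_def)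
    have "a \<in> universe A" using that(2) vars by force
    from ext[OF h this] u have "h(a \<mapsto> F u a) \<in> H" by (auto simp: H_def)
    moreover have "h \<subseteq>\<^sub>m h(a \<mapsto> F u a)" using that(3) by (auto simp: map_le_def)
    ultimately show ?thesis by (intro bexI[of _ "h(a \<mapsto> F u a)"]) auto
  qed
  have un: "\<exists>h'\<in>H. h \<subseteq>\<^sub>m h' \<and> dom h' = insert a (dom h) \<and> h' a = Some b"
    if "h \<in> H" "b \<in> universe B" "(Universal, a) \<in> set p" "a \<notin> dom h"
      "\<forall>x\<in>dom h. comes_after p a x" for h a b
  proof -
    obtain u where u: "range u \<subseteq> universe B" and h: "h \<subseteq>\<^sub>m ?full u"
      using \<open>h \<in> H\<close> by (auto simp: H_def)
    define u' where "u' = u(a := b)"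
    have u': "range u' \<subseteq> universe B" using u that(2) by (auto simp: u'_def)
    \<comment> \<open>Switching to \<open>u'\<close> must not disturb \<open>h\<close>: a universal
      \<open>x\<close> differs from \<open>a\<close>, and an existential \<open>x\<close> is not
      preceded by \<open>a\<close>.\<close>
    have "F u x = F u' x" if x: "x \<in> dom h" for x
    proof -
      have "x \<noteq> a" using x \<open>a \<notin> dom h\<close> by blast
      have "x \<in> snd ` set p" using x dom[OF h] vars by auto
      then obtain q where q: "(q, x) \<in> set p" by auto
      show ?thesis
      proof (cases q)
        case Universal
        then show ?thesis
          using q \<open>x \<noteq> a\<close> skolemizesD(4)[OF F u, of x] skolemizesD(4)[OF F u', of x]
          by (simp add: u'_def)
      next
        case Existential
        obtain ps qs where p: "p = ps @ (Existential, x) # qs"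
          using q Existential by (auto dest: split_list)
        have "(Universal, a) \<notin> set ps"
          using comes_after_not_precedes[OF dist p] that x \<open>\<forall>x\<in>dom h. comes_after p a x\<close> by auto
        then show ?thesis by (intro skolemizes_cong[OF F u u' p]) (auto simp: u'_def)
      qed
    qed
    then have h': "h \<subseteq>\<^sub>m ?full u'"
      using val[OF h] dom[OF h] by (auto simp: map_le_def restrict_map_def)
    have "a \<in> universe A" using that(3) vars by force
    from ext[OF h' this] u' have "h(a \<mapsto> F u' a) \<in> H" by (auto simp: H_def)
    moreover have "F u' a = b" using skolemizesD(4)[OF F u' that(3)] by (simp add: u'_def)
    moreover have "h \<subseteq>\<^sub>m h(a \<mapsto> F u' a)" using that(4) by (auto simp: map_le_def)
    ultimately show ?thesis by (intro bexI[of _ "h(a \<mapsto> F u' a)"]) auto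
  qed
  have sub: "g \<in> H" if "h \<in> H" "g \<subseteq>\<^sub>m h" for h g
    using that map_le_trans unfolding H_def by blast
  show ?thesis
    unfolding winning_strategy_def
    apply (intro conjI ne)
    subgoal using proj by blast
    subgoal using ex by blast
    subgoal using un by blast
    subgoal using sub by blast
    done
qed

section \<open>Schemes of minimum weight\<close>

text \<open>Guarantees that the minimum in \<open>coverwidth\<close> ranges over a nonempty set. Any
  two distinct vertices are adjacent, so the order of the prefix itself is a perfect elimination
  ordering.\<close>

lemma complete_graph_is_scheme:
  assumes "is_quantified_structure \<sigma> p A"
  shows "is_scheme \<sigma> p A {e. e \<subseteq> universe A \<and> card e = 2}"
proof -
  let ?F = "{e. e \<subseteq> universe A \<and> card e = 2}" and ?vs = "map snd p"
  have dist: "distinct ?vs" and vars: "set ?vs = universe A" and str: "is_structure \<sigma> A"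
    using assms by (auto simp: is_quantified_structure_def)
  have "{?vs ! i, ?vs ! j} \<in> ?F" if "i < j" "j < length ?vs" for i j
  proof -
    have "?vs ! i \<in> universe A" "?vs ! j \<in> universe A" "?vs ! i \<noteq> ?vs ! j"
      using that dist nth_mem[of i ?vs] nth_mem[of j ?vs] nth_eq_iff_index_eq[OF dist, of i j]
      unfolding vars by auto
    then show ?thesis by auto
  qed
  then have "perfect_elimination_ordering (universe A) ?F ?vs"
    unfolding perfect_elimination_ordering_def using dist vars by (meson less_trans)
  moreover have "respects_prefix p ?vs"
    unfolding respects_prefix_def
  proof (intro allI impI)
    fix i j assume "i < j \<and> j < length ?vs"
    then show "comes_after p (?vs ! j) (?vs ! i)"
      unfolding comes_after_def by (intro exI[of _ i] exI[of _ j]) (simp add: block_index_mono)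
  qed
  moreover have "is_clique (universe A) ?F e" if "e \<in> hyperedges \<sigma> A" for e
    using that str by (auto simp: hyperedges_def is_structure_def is_clique_def)
  ultimately show ?thesis unfolding is_scheme_def is_graph_def by blast
qed

lemma coverwidth_scheme:
  assumes "is_quantified_structure \<sigma> p A"
  obtains F where "is_scheme \<sigma> p A F"
    and "\<And>K. is_clique (universe A) F K \<Longrightarrow> weight \<sigma> A K \<le> coverwidth \<sigma> p A"
proof -
  have "\<exists>w F. is_scheme \<sigma> p A F \<and> scheme_weight \<sigma> A F = w"
    using complete_graph_is_scheme[OF assms] by blast
  then have "\<exists>F. is_scheme \<sigma> p A F \<and> scheme_weight \<sigma> A F = coverwidth \<sigma> p A"
    unfolding coverwidth_def by (rule LeastI_ex)
  then obtain F where F: "is_scheme \<sigma> p A F" "scheme_weight \<sigma> A F = coverwidth \<sigma> p A" by blast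
  \<comment> \<open>Finitely many cliques make \<open>Max\<close> an upper bound for their
    weights.\<close>
  have "{K. is_clique (universe A) F K} \<subseteq> Pow (universe A)" by (auto simp: is_clique_def)
  moreover have "finite (universe A)"
    using assms by (auto simp: is_quantified_structure_def is_structure_def)
  ultimately have "finite {K. is_clique (universe A) F K}" by (meson finite_Pow_iff finite_subset)
  then have "weight \<sigma> A K \<le> coverwidth \<sigma> p A" if "is_clique (universe A) F K" for K
    unfolding F(2)[symmetric] scheme_weight_def using that by (intro Max_ge) auto
  with F(1) show ?thesis by (rule that)
qed

section \<open>Valuing the elements along an elimination ordering\<close>

lemma winning_strategy_map_le:
  "winning_strategy \<sigma> k p A B H \<Longrightarrow> h \<in> H \<Longrightarrow> g \<subseteq>\<^sub>m h \<Longrightarrow> g \<in> H"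
  by (simp add: winning_strategy_def)

text \<open>Hilbert choice makes the answer at an existential \<open>a\<close> a function of the
  position \<open>h\<close>, independent of \<open>b\<close>; the Skolem dependence rests on
  this.\<close>

definition response :: "('a \<rightharpoonup> 'b) set \<Rightarrow> 'a prefix \<Rightarrow> ('a \<rightharpoonup> 'b) \<Rightarrow> 'a \<Rightarrow> 'b \<Rightarrow> 'b" where
  "response H p h a b = (if (Universal, a) \<in> set p then b else SOME c. h(a \<mapsto> c) \<in> H)"

text \<open>The strategy supplies an extension \<open>h'\<close> of \<open>h\<close> to
  \<open>a\<close>. With \<open>c\<close> its value at \<open>a\<close>, the map
  \<open>h(a \<mapsto> c)\<close> is a subfunction of \<open>h'\<close> and so lies in
  \<open>H\<close>.\<close>

lemma response_in:
  assumes H: "winning_strategy \<sigma> k p A B H" and h: "h \<in> H" and a: "a \<in> snd ` set p" "a \<notin> dom h"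
    and after: "\<And>x. x \<in> dom h \<Longrightarrow> comes_after p a x" and w: "weight \<sigma> A (insert a (dom h)) \<le> k"
    and b: "b \<in> universe B"
  shows "h(a \<mapsto> response H p h a b) \<in> H"
proof -
  have ext: "h(a \<mapsto> c) \<in> H" if "h' \<in> H" "h \<subseteq>\<^sub>m h'" "h' a = Some c" for h' c
  proof -
    have "h(a \<mapsto> c) \<subseteq>\<^sub>m h'" using that(2,3) by (auto simp: map_le_def)
    then show ?thesis by (rule winning_strategy_map_le[OF H that(1)])
  qed
  have after': "\<forall>x\<in>dom h. comes_after p a x" using after by blast
  show ?thesis
  proof (cases "(Universal, a) \<in> set p")
    case True
    then have "\<exists>h'\<in>H. h \<subseteq>\<^sub>m h' \<and> dom h' = insert a (dom h) \<and> h' a = Some b"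
      using H h a(2) after' w b by (simp add: winning_strategy_def)
    then obtain h' where "h' \<in> H" "h \<subseteq>\<^sub>m h'" "h' a = Some b" by blast
    from ext[OF this] True show ?thesis by (simp add: response_def)
  next
    case False
    obtain q where q: "(q, a) \<in> set p" using a(1) by auto
    with False have "(Existential, a) \<in> set p" by (cases q) auto
    then have "\<exists>h'\<in>H. h \<subseteq>\<^sub>m h' \<and> dom h' = insert a (dom h)"
      using H h a(2) after' w by (simp add: winning_strategy_def)
    then obtain h' where h': "h' \<in> H" "h \<subseteq>\<^sub>m h'" "dom h' = insert a (dom h)" by blast
    then obtain c where "h' a = Some c" by (metis domD insertI1)
    with h' have "h(a \<mapsto> c) \<in> H" by (intro ext)
    then have "h(a \<mapsto> (SOME c. h(a \<mapsto> c) \<in> H)) \<in> H"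
      by - (rule someI[of "\<lambda>c. h(a \<mapsto> c) \<in> H"])
    then show ?thesis using False by (simp add: response_def)
  qed
qed

text \<open>Each answer looks only at the neighbours already valued: the whole partial assignment
  may have weight above \<open>k\<close> and need not belong to \<open>H\<close>.\<close>

definition play ::
    "('a \<rightharpoonup> 'b) set \<Rightarrow> 'a prefix \<Rightarrow> 'a set set \<Rightarrow> ('a \<Rightarrow> 'b) \<Rightarrow> 'a list \<Rightarrow> ('a \<rightharpoonup> 'b)" where
  "play H p F u =
     foldl (\<lambda>g x. g(x \<mapsto> response H p (g |` {y. {y, x} \<in> F}) x (u x))) Map.empty"

lemma play_Nil [simp]: "play H p F u [] = Map.empty"
  by (simp add: play_def)

lemma play_snoc [simp]:
  "play H p F u (us @ [x]) = (play H p F u us)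
     (x \<mapsto> response H p (play H p F u us |` {y. {y, x} \<in> F}) x (u x))"
  by (simp add: play_def)

lemma dom_play [simp]: "dom (play H p F u us) = set us"
  by (induction us rule: rev_induct) (simp_all del: fun_upd_apply)

lemma play_Universal:
  "x \<in> set us \<Longrightarrow> (Universal, x) \<in> set p \<Longrightarrow> play H p F u us x = Some (u x)"
  by (induction us rule: rev_induct) (auto simp: response_def)

lemma play_append:
  "x \<notin> set ws \<Longrightarrow> play H p F u (us @ ws) x = play H p F u us x"
  by (induction ws rule: rev_induct) (auto simp flip: append_assoc)

text \<open>Existential answers are computed from earlier values alone, so \<open>u\<close> enters
  only at universal elements of \<open>us\<close>.\<close>

lemma play_cong:
  assumes "\<And>x. x \<in> set us \<Longrightarrow> (Universal, x) \<in> set p \<Longrightarrow> u x = u' x"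
  shows "play H p F u us = play H p F u' us"
  using assms by (induction us rule: rev_induct) (auto simp: response_def)

text \<open>Induction along the ordering. The claim covers all cliques among the valued elements,
  because the position used for the next element is the restriction to a clique not known in
  advance.\<close>

lemma play_in_strategy:
  assumes H: "winning_strategy \<sigma> k p A B H" and vars: "snd ` set p = universe A"
    and weight: "\<And>K. is_clique (universe A) F K \<Longrightarrow> weight \<sigma> A K \<le> k"
    and peo: "perfect_elimination_ordering (universe A) F vs" and resp: "respects_prefix p vs"
    and u: "range u \<subseteq> universe B"
  shows "vs = us @ ws \<Longrightarrow> is_clique (universe A) F K \<Longrightarrow> K \<subseteq> set us \<Longrightarrow> play H p F u us |` K \<in> H"
proof (induction us arbitrary: ws K rule: rev_induct)
  case Nil
  obtain h where "h \<in> H" using H by (auto simp: winning_strategy_def)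
  then have "Map.empty \<in> H" by (rule winning_strategy_map_le[OF H]) simp
  then show ?case by simp
next
  case (snoc x us)
  let ?g = "play H p F u us" and ?N = "{y \<in> set us. {y, x} \<in> F}"
  have vs: "vs = us @ x # ws" using snoc.prems(1) by simp
  have dist: "distinct vs" and set_vs: "set vs = universe A"
    using peo by (auto simp: perfect_elimination_ordering_def)
  have x: "x \<notin> set us" "x \<in> universe A" "set us \<subseteq> universe A" using dist set_vs vs by auto
  \<comment> \<open>The element \<open>x\<close> has index \<open>length us\<close> in
    \<open>vs\<close>; the elimination condition with this as last index makes its earlier
    neighbours pairwise adjacent.\<close>
  have nbrs: "{y, z} \<in> F" if yz: "y \<in> ?N" "z \<in> ?N" "y \<noteq> z" for y z
  proof -
    obtain i j where ij: "i < length us" "j < length us" "us ! i = y" "us ! j = z"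
      using yz by (auto simp: in_set_conv_nth)
    then have nth: "vs ! i = y" "vs ! j = z" "vs ! length us = x" "length us < length vs"
      by (auto simp: vs nth_append)
    have *: "{vs ! i, vs ! j} \<in> F"
      if "i < j" "j < l" "l < length vs" "{vs ! i, vs ! l} \<in> F" "{vs ! j, vs ! l} \<in> F" for i j l
      using that peo unfolding perfect_elimination_ordering_def by blast
    have "i \<noteq> j" using ij yz(3) by auto
    then consider "i < j" | "j < i" by linarith
    then show ?thesis
    proof cases
      case 1
      then show ?thesis using *[of i j "length us"] ij nth yz by auto
    next
      case 2
      then show ?thesis using *[of j i "length us"] ij nth yz by (auto simp: insert_commute)
    qed
  qed
  have after: "comes_after p x y" if y: "y \<in> set us" for y
  proof -
    obtain i where i: "i < length us" "us ! i = y" using y by (auto simp: in_set_conv_nth)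
    then have "vs ! i = y" "vs ! length us = x" "length us < length vs"
      by (auto simp: vs nth_append)
    then show ?thesis using resp i unfolding respects_prefix_def by blast
  qed
  \<comment> \<open>Being a clique, this set has weight at most \<open>k\<close>, so the game
    permits the move at \<open>x\<close>.\<close>
  have clique: "is_clique (universe A) F (insert x ?N)"
    using nbrs x by (auto simp: is_clique_def insert_commute)
  then have "is_clique (universe A) F ?N" by (auto simp: is_clique_def)
  then have N: "?g |` ?N \<in> H" using snoc.IH[OF vs] by blast
  have dom_N: "dom (?g |` ?N) = ?N" by auto
  \<comment> \<open>Neighbours not yet valued lie outside the domain of \<open>?g\<close>.\<close>
  have restrict: "?g |` {y. {y, x} \<in> F} = ?g |` ?N"
  proof
    fix y show "(?g |` {y. {y, x} \<in> F}) y = (?g |` ?N) y"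
      using domIff[of y "play H p F u us"] by (simp add: restrict_map_def)
  qed
  define c where "c = response H p (?g |` ?N) x (u x)"
  have in_H: "(?g |` ?N)(x \<mapsto> c) \<in> H"
    unfolding c_def
  proof (rule response_in[OF H N])
    show "x \<in> snd ` set p" using x vars by simp
    show "x \<notin> dom (?g |` ?N)" using x dom_N by blast
    show "comes_after p x y" if "y \<in> dom (?g |` ?N)" for y using that dom_N after by blast
    show "weight \<sigma> A (insert x (dom (?g |` ?N))) \<le> k" unfolding dom_N by (rule weight[OF clique])
    show "u x \<in> universe B" using u by auto
  qed
  have play: "play H p F u (us @ [x]) = ?g(x \<mapsto> c)"
    by (simp only: play_snoc restrict c_def)
  \<comment> \<open>If \<open>x\<close> is in \<open>K\<close>, the rest of \<open>K\<close>
    consists of earlier neighbours of \<open>x\<close>, and closure under subfunctions applies;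
    otherwise the new value is invisible on \<open>K\<close>.\<close>
  show ?case
  proof (cases "x \<in> K")
    case True
    then have "K \<subseteq> insert x ?N" using snoc.prems(2,3) by (auto simp: is_clique_def)
    then have "(?g(x \<mapsto> c)) |` K \<subseteq>\<^sub>m (?g |` ?N)(x \<mapsto> c)"
      by (auto simp: map_le_def restrict_map_def)
    with in_H show ?thesis unfolding play by (rule winning_strategy_map_le[OF H])
  next
    case False
    then have "K \<subseteq> set us" using snoc.prems(3) by auto
    from snoc.IH[OF vs snoc.prems(2) this] False show ?thesis
      unfolding play by (simp del: fun_upd_apply)
  qed
qed

section \<open>From a winning strategy to Skolem functions\<close>

lemma skolemizes_of_winning_strategy:
  fixes p :: "'a prefix" and B :: "('s, 'b) rel_structure"
  assumes A: "is_quantified_structure \<sigma> p A" and B: "is_structure \<sigma> B"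
    and H: "winning_strategy \<sigma> k p A B H" and k: "coverwidth \<sigma> p A \<le> k"
  shows "\<exists>G. skolemizes (universe B) p (canonical_conjunction \<sigma> A B) s G"
proof -
  have dist: "distinct (map snd p)" and vars: "snd ` set p = universe A"
    and str: "is_structure \<sigma> A"
    using A by (auto simp: is_quantified_structure_def)
  obtain F where F: "is_scheme \<sigma> p A F"
    and weight_F: "\<And>K. is_clique (universe A) F K \<Longrightarrow> weight \<sigma> A K \<le> coverwidth \<sigma> p A"
    using coverwidth_scheme[OF A] by blast
  obtain vs where peo: "perfect_elimination_ordering (universe A) F vs"
    and resp: "respects_prefix p vs" using F by (auto simp: is_scheme_def)
  have weight: "weight \<sigma> A K \<le> k" if "is_clique (universe A) F K" for K
    using weight_F[OF that] k by simp
  have dist_vs: "distinct vs" and set_vs: "set vs = universe A"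
    using peo by (auto simp: perfect_elimination_ordering_def)
  \<comment> \<open>Every element of the universe occurs in \<open>vs\<close>, so \<open>the\<close>
    is applied to a defined value there; outside, \<open>s\<close> is what \<open>skolemizes\<close>
    prescribes.\<close>
  define G where "G = (\<lambda>u x. if x \<in> universe A then the (play H p F u vs x) else s x)"
  have G: "play H p F u vs x = Some (G u x)" if "x \<in> universe A" for u x
  proof -
    have "x \<in> dom (play H p F u vs)" using that set_vs by simp
    then obtain b where "play H p F u vs x = Some b" by blast
    then show ?thesis using that by (simp add: G_def)
  qed
  have proj: "projective_homomorphism \<sigma> A B (play H p F u vs |` K)"
    if "range u \<subseteq> universe B" "is_clique (universe A) F K" for u K
  proof -
    have "K \<subseteq> set vs" using that(2) set_vs by (auto simp: is_clique_def)
    from play_in_strategy[OF H vars weight peo resp that(1) _ that(2) this, of "[]"]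
    show ?thesis using H by (auto simp: winning_strategy_def)
  qed
  have "skolemizes (universe B) p (canonical_conjunction \<sigma> A B) s G"
  proof (rule skolemizesI)
    fix u :: "'a \<Rightarrow> 'b" and x assume u: "range u \<subseteq> universe B"
    show "canonical_conjunction \<sigma> A B (G u)"
      unfolding canonical_conjunction_def
    proof (intro ballI)
      fix R as assume R: "R \<in> symbols \<sigma>" and as: "as \<in> interp A R"
      then have "set as \<in> hyperedges \<sigma> A" by (auto simp: hyperedges_def)
      then have "is_clique (universe A) F (set as)" using F by (simp add: is_scheme_def)
      from proj[OF u this] R as obtain bs where bs: "bs \<in> interp B R"
        "\<forall>i<length as. as ! i \<in> dom (play H p F u vs |` set as) \<longrightarrow>
           (play H p F u vs |` set as) (as ! i) = Some (bs ! i)"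
        unfolding projective_homomorphism_def by blast
      \<comment> \<open>A projective homomorphism compares only positions below
        \<open>length as\<close>; the common arity turns this into equality of tuples.\<close>
      have len: "length as = arity \<sigma> R" "length bs = arity \<sigma> R" and sub: "set as \<subseteq> universe A"
        using str B R as bs(1) by (auto simp: is_structure_def)
      have "map (G u) as = bs"
      proof (rule nth_equalityI)
        fix i assume "i < length (map (G u) as)"
        then have i: "i < length as" by simp
        then have "as ! i \<in> set as" by simp
        with sub have "play H p F u vs (as ! i) = Some (G u (as ! i))" by (intro G) blast
        with bs(2) i have "G u (as ! i) = bs ! i"
          by (auto simp: restrict_map_def)
        then show "map (G u) as ! i = bs ! i" using i by simp
      qed (simp add: len)
      then show "map (G u) as \<in> interp B R" using bs(1) by simp
    qed
    show "G u x \<in> universe B" if "x \<in> snd ` set p"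
    proof -
      have x: "x \<in> universe A" using that vars by simp
      \<comment> \<open>Singletons are cliques, so even an element in no hyperedge receives a value
        in \<open>B\<close>.\<close>
      then have "is_clique (universe A) F {x}" by (auto simp: is_clique_def)
      from proj[OF u this] have "ran (play H p F u vs |` {x}) \<subseteq> universe B"
        by (simp add: projective_homomorphism_def)
      moreover have "G u x \<in> ran (play H p F u vs |` {x})"
        using G[OF x, of u] by (intro ranI[of _ x]) simp
      ultimately show ?thesis by blast
    qed
    show "G u x = s x" if "x \<notin> snd ` set p" using that vars by (simp add: G_def)
    show "G u x = u x" if "(Universal, x) \<in> set p"
    proof -
      have x: "x \<in> universe A" using that vars by force
      then have "play H p F u vs x = Some (u x)" using that set_vs by (simp add: play_Universal)
      then show ?thesis using G[OF x, of u] by simp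
    qed
  next
    fix u u' :: "'a \<Rightarrow> 'b" and ps x qs
    assume p: "p = ps @ (Existential, x) # qs"
      and agree: "\<And>y. (Universal, y) \<in> set ps \<Longrightarrow> u y = u' y"
    have x: "x \<in> universe A" using vars by (force simp: p)
    have not_univ: "(Universal, x) \<notin> set p" using dist by (force simp: p)
    from x obtain us ws where vs: "vs = us @ x # ws"
      using split_list[of x vs] by (auto simp: set_vs)
    \<comment> \<open>A universal \<open>y\<close> is not \<open>x\<close>, so it stands before
      \<open>x\<close> in \<open>vs\<close>; as the ordering respects the prefix, it also precedes
      \<open>x\<close> in \<open>p\<close>.\<close>
    have "u y = u' y" if y: "y \<in> set (us @ [x])" and "(Universal, y) \<in> set p" for y
    proof (rule agree)
      have "y \<in> set us" using y not_univ \<open>(Universal, y) \<in> set p\<close> by auto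
      then obtain i where i: "i < length us" "us ! i = y" by (auto simp: in_set_conv_nth)
      then have "vs ! i = y" "vs ! length us = x" "length us < length vs"
        by (auto simp: vs nth_append)
      then have "comes_after p x y" using resp i unfolding respects_prefix_def by blast
      then show "(Universal, y) \<in> set ps"
        using comes_after_precedes[OF dist p \<open>(Universal, y) \<in> set p\<close>] by simp
    qed
    then have "play H p F u (us @ [x]) = play H p F u' (us @ [x])" by (rule play_cong)
    \<comment> \<open>Elements valued after \<open>x\<close> do not change its value.\<close>
    moreover have "play H p F w vs x = play H p F w (us @ [x]) x" for w
      using play_append[of x ws H p F w "us @ [x]"] dist_vs by (simp add: vs)
    ultimately have "play H p F u vs x = play H p F u' vs x" by (simp only:)
    then show "G u x = G u' x" by (simp add: G_def)
  qed
  then show ?thesis by - (rule exI)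
qed

theorem theorem9:
  fixes \<sigma> :: "'s signature"
    and p :: "'a prefix"
    and A :: "('s, 'a) rel_structure"
    and B :: "('s, 'b) rel_structure"
    and k :: nat
  assumes "finite_signature \<sigma>"
    and "is_quantified_structure \<sigma> p A"
    and "is_structure \<sigma> B"
    and "universe B \<noteq> {}"
    and "k \<ge> 1"
    and "coverwidth \<sigma> p A \<le> k"
  shows "(\<exists>H. winning_strategy \<sigma> k p A B H) \<longleftrightarrow> has_homomorphism \<sigma> p A B"
proof -
  have "distinct (map snd p)" using assms(2) by (simp add: is_quantified_structure_def)
  note hom = prenex_holds_iff_skolemizes[OF this assms(4)]
  show ?thesis
    unfolding has_homomorphism_def hom
  proof (intro iffI allI)
    fix s assume "\<exists>H. winning_strategy \<sigma> k p A B H"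
    then show "\<exists>G. skolemizes (universe B) p (canonical_conjunction \<sigma> A B) s G"
      by (elim exE) (rule skolemizes_of_winning_strategy[OF assms(2,3) _ assms(6)])
  next
    assume "\<forall>s. \<exists>G. skolemizes (universe B) p (canonical_conjunction \<sigma> A B) s G"
    \<comment> \<open>One initial assignment suffices; \<open>undefined\<close> merely picks
      one.\<close>
    then obtain G where "skolemizes (universe B) p (canonical_conjunction \<sigma> A B) undefined G"
      by (elim allE exE)
    then show "\<exists>H. winning_strategy \<sigma> k p A B H"
      by - (rule exI, rule winning_strategy_of_skolemizes[OF assms(2,4)])
  qed
qed

end
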